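(* Let $G$ be a finite group, let $\pi$ be a set of primes, and assume that $G$ has a normal Hall $\pi$-subgroup $N$. Denote by $H$ a $\pi$-complement of $G$. Then all elements of $G$ outside of $N\mathbf{C}_H(N)$ lie in conjugacy classes of $G$ of the same size $s$ (for some positive integer $s$) if and only if the following hold: (a) $|H:\mathbf{C}_H(h)|$ has the same value for all $h\in H\setminus\mathbf{C}_H(N)$; (b) $|N:\mathbf{C}_N(h)|$ has the same value for all $h\in H\setminus\mathbf{C}_H(N)$; (c) $\mathbf{C}_N(\mathbf{C}_H(h))=\mathbf{C}_N(h)$ for every element $h\in H\setminus\mathbf{C}_H(N)$; (d) $\mathbf{C}_N(h)$ is abelian for every element $h\in H\setminus\mathbf{C}_H(N)$. In this situation, $|H:\mathbf{C}_H(h)|=s_{\pi'}$ and $|N:\mathbf{C}_N(h)|=s_{\pi}$ for all $h\in H\setminus\mathbf{C}_H(N)$.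
   Context: $\mathbf{C}_A(B)$ denotes the centralizer of $B$ in $A$. A $\pi$-complement of $G$ is a Hall $\pi'$-subgroup of $G$, where $\pi'$ is the set of primes not in $\pi$. For a positive integer $n$, $n_\pi$ and $n_{\pi'}$ denote the $\pi$-part and the $\pi'$-part of $n$, respectively. *)

theory Defs
  imports
    "HOL-Algebra.Coset"
    "HOL-Algebra.Group_Action"
    "HOL-Computational_Algebra.Primes"
begin

definition prime_compl :: "nat set \<Rightarrow> nat set" where
  "prime_compl \<pi> = {p. prime p \<and> p \<notin> \<pi>}"

definition pi_number :: "nat set \<Rightarrow> nat \<Rightarrow> bool" where
  "pi_number \<pi> n \<longleftrightarrow> n > 0 \<and> (\<forall>p. prime p \<and> p dvd n \<longrightarrow> p \<in> \<pi>)"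

definition pi_part :: "nat set \<Rightarrow> nat \<Rightarrow> nat" where
  "pi_part \<pi> n = (\<Prod>p \<in> prime_factors n \<inter> \<pi>. p ^ multiplicity p n)"

text \<open>The index \<open>|H : K|\<close> of \<open>K\<close> in a subgroup \<open>H\<close> of \<open>G\<close>; the cosets are formed
  inside \<open>H\<close>, so that \<open>H\<close> may be a proper subgroup.\<close>

definition subgroup_index :: "('a, 'b) monoid_scheme \<Rightarrow> 'a set \<Rightarrow> 'a set \<Rightarrow> nat" where
  "subgroup_index G H K = card (rcosets\<^bsub>G\<lparr>carrier := H\<rparr>\<^esub> K)"

definition hall_subgroup :: "('a, 'b) monoid_scheme \<Rightarrow> nat set \<Rightarrow> 'a set \<Rightarrow> bool" where
  "hall_subgroup G \<pi> H \<longleftrightarrow> subgroup H G \<and> pi_number \<pi> (card H)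
     \<and> pi_number (prime_compl \<pi>) (subgroup_index G (carrier G) H)"

definition pi_complement :: "('a, 'b) monoid_scheme \<Rightarrow> nat set \<Rightarrow> 'a set \<Rightarrow> bool" where
  "pi_complement G \<pi> H \<longleftrightarrow> hall_subgroup G (prime_compl \<pi>) H"

text \<open>\<open>centralizer G A B\<close> is \<open>C\<^sub>A(B)\<close>; for an element \<open>h\<close>, \<open>C\<^sub>A(h)\<close> is
  \<open>centralizer G A {h}\<close>.\<close>

definition centralizer :: "('a, 'b) monoid_scheme \<Rightarrow> 'a set \<Rightarrow> 'a set \<Rightarrow> 'a set" where
  "centralizer G A B = {a \<in> A. \<forall>b \<in> B. a \<otimes>\<^bsub>G\<^esub> b = b \<otimes>\<^bsub>G\<^esub> a}"

definition conj_class :: "('a, 'b) monoid_scheme \<Rightarrow> 'a \<Rightarrow> 'a set" where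
  "conj_class G x =
     orbit G (\<lambda>g. \<lambda>y \<in> carrier G. g \<otimes>\<^bsub>G\<^esub> y \<otimes>\<^bsub>G\<^esub> inv\<^bsub>G\<^esub> g) x"

end

theory Submission
  imports
    Defs
    "HOL-Algebra.Multiplicative_Group"
    "HOL-Number_Theory.Cong"
begin

text \<open>
  Since \<open>|N|\<close> and \<open>|H|\<close> are coprime, \<open>G = NH\<close> with \<open>N \<inter> H = 1\<close>, and there is an
  exponent \<open>e\<close> that kills \<open>N\<close> and fixes \<open>H\<close> elementwise. Hence, for \<open>h \<in> H\<close> and
  \<open>c \<in> C\<^sub>N(h)\<close>, the factor \<open>h = (ch)\<^sup>e\<close> can be recovered from the product \<open>ch\<close>. Everything
  rests on this power, and on uniqueness of the factorization in \<open>NH\<close>.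

  The first consequence is that every element of the coset \<open>Nh\<close> is conjugate under \<open>N\<close>
  to an element \<open>ch\<close> with \<open>c \<in> C\<^sub>N(h)\<close> (\<open>conj_into_centralizer_coset\<close>). This is a
  count: an element of \<open>N\<close> that takes
  some \<open>ch\<close> to some \<open>c'h\<close> centralizes \<open>h\<close>, so that the conjugates of
  \<open>C\<^sub>N(h)h\<close> are \<open>|N : C\<^sub>N(h)|\<close> pairwise disjoint sets of size \<open>|C\<^sub>N(h)|\<close> and fill the
  coset. It therefore suffices to know the class sizes of the elements \<open>ch\<close>; such an element
  lies outside \<open>N C\<^sub>H(N)\<close> exactly when \<open>h\<close> lies outside \<open>C\<^sub>H(N)\<close>.

  The second consequence is that \<open>C\<^sub>G(ch) = C\<^sub>G(c) \<inter> C\<^sub>G(h)\<close>. So \<open>ch\<close> and \<open>h\<close>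
  have classes of the same size if and only if \<open>C\<^sub>G(h) \<le> C\<^sub>G(c)\<close>. As
  \<open>C\<^sub>G(h) = C\<^sub>N(h) C\<^sub>H(h)\<close>, this holds for all \<open>c \<in> C\<^sub>N(h)\<close> if and only if
  \<open>C\<^sub>N(h)\<close> is abelian and is centralized by \<open>C\<^sub>H(h)\<close>, which are conditions (d) and (c)
  for \<open>h\<close> (\<open>centralizes_iff\<close>). The same factorization gives the size of the class of
  \<open>h\<close> as \<open>|N : C\<^sub>N(h)| |H : C\<^sub>H(h)|\<close>. These two indices are a \<open>\<pi>\<close>-number and a
  \<open>\<pi>'\<close>-number, so their product determines each of them; hence its being constant amounts
  to (a) and (b).
\<close>

section \<open>The \<open>\<pi>\<close>-part of a natural number\<close>

lemma coprime_pi_numbers: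
  assumes "pi_number \<pi> a" "pi_number (prime_compl \<pi>) b"
  shows "coprime a b"
proof (rule ccontr)
  assume "\<not> coprime a b"
  then obtain p where "prime p" "p dvd a" "p dvd b"
    by (metis coprime_iff_gcd_eq_1 dvd_trans gcd_dvd1 gcd_dvd2 prime_factor_nat)
  then show False
    using assms by (auto simp: pi_number_def prime_compl_def)
qed

lemma pi_number_dvd:
  assumes "pi_number \<pi> a" "b dvd a"
  shows "pi_number \<pi> b"
  using assms by (auto simp: pi_number_def dest: dvd_trans intro!: Nat.gr0I)

lemma pi_part_mult:
  assumes a: "pi_number \<pi> a" and b: "pi_number (prime_compl \<pi>) b"
  shows "pi_part \<pi> (a * b) = a"
proof -
  have nz: "a \<noteq> 0" "b \<noteq> 0"
    using a b by (auto simp: pi_number_def)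
  have "prime_factors (a * b) \<inter> \<pi> = prime_factors a"
    using a b nz
    by (auto simp: pi_number_def prime_compl_def prime_factors_dvd
        prime_dvd_mult_iff)
  moreover have "multiplicity p (a * b) = multiplicity p a" if "p \<in> prime_factors a" for p
  proof -
    have "prime p" "\<not> p dvd b"
      using that a b by (auto simp: pi_number_def prime_compl_def prime_factors_dvd)
    then show ?thesis
      using nz by (simp add: prime_elem_multiplicity_mult_distrib not_dvd_imp_multiplicity_0)
  qed
  ultimately have "pi_part \<pi> (a * b) = (\<Prod>p \<in> prime_factors a. p ^ multiplicity p a)"
    by (simp add: pi_part_def)
  also have "\<dots> = a"
    using nz by (simp add: prod_prime_factors)
  finally show ?thesis .
qed

lemma prime_compl_involutive:
  assumes "\<forall>p \<in> \<pi>. prime p"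
  shows "prime_compl (prime_compl \<pi>) = \<pi>"
  using assms by (auto simp: prime_compl_def)

section \<open>Centralizers, indices and conjugacy classes\<close>

lemma in_centralizer_singleton [simp]:
  "a \<in> centralizer G A {x} \<longleftrightarrow> a \<in> A \<and> a \<otimes>\<^bsub>G\<^esub> x = x \<otimes>\<^bsub>G\<^esub> a"
  by (simp add: centralizer_def)

context group
begin

lemma inv_commutes:
  assumes "x \<in> carrier G" "y \<in> carrier G" "x \<otimes> y = y \<otimes> x"
  shows "inv x \<otimes> y = y \<otimes> inv x"
  by (metis assms inv_closed inv_solve_left inv_solve_right m_assoc m_closed)

lemma mult_commutes:
  assumes "x \<in> carrier G" "y \<in> carrier G" "z \<in> carrier G"
    and "x \<otimes> z = z \<otimes> x" "y \<otimes> z = z \<otimes> y"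
  shows "x \<otimes> y \<otimes> z = z \<otimes> (x \<otimes> y)"
  by (metis assms m_assoc)

lemma pow_commutes:
  assumes "x \<in> carrier G" "y \<in> carrier G" "x \<otimes> y = y \<otimes> x"
  shows "x [^] (n::nat) \<otimes> y = y \<otimes> x [^] n"
  using assms by (induction n) (simp_all add: mult_commutes)

lemma subgroup_centralizer:
  assumes "subgroup A G" "B \<subseteq> carrier G"
  shows "subgroup (centralizer G A B) G"
proof -
  interpret A: subgroup A G by fact
  show ?thesis
    by (rule subgroup.intro)
      (use assms(2) in \<open>auto simp: centralizer_def subset_iff intro!: inv_commutes mult_commutes\<close>)
qed

lemma subgroup_index_mult_card:
  assumes "subgroup A G" "subgroup K G" "K \<subseteq> A" "finite A"
  shows "subgroup_index G A K * card K = card A"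
proof -
  interpret A: group "G\<lparr>carrier := A\<rparr>"
    using assms(1) by (rule subgroup.subgroup_is_group) (rule is_group)
  have "subgroup K (G\<lparr>carrier := A\<rparr>)"
    using assms by (simp add: subgroup_incl)
  from A.lagrange[OF this] show ?thesis
    by (simp add: subgroup_index_def order_def)
qed

lemma subgroup_pow_card_eq_one:
  assumes "subgroup A G" "finite A" "x \<in> A"
  shows "x [^] card A = \<one>"
proof -
  interpret A: group "G\<lparr>carrier := A\<rparr>"
    using assms(1) by (rule subgroup.subgroup_is_group) (rule is_group)
  show ?thesis
    using A.pow_order_eq_1[of x] assms by (simp add: order_def nat_pow_consistent[symmetric])
qed

lemma conj_pow:
  assumes "g \<in> carrier G" "x \<in> carrier G"
  shows "(g \<otimes> x \<otimes> inv g) [^] (i::nat) = g \<otimes> x [^] i \<otimes> inv g"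
proof (induction i)
  case (Suc i)
  have "g \<otimes> x [^] i \<otimes> inv g \<otimes> (g \<otimes> x \<otimes> inv g)
      = g \<otimes> x [^] i \<otimes> (inv g \<otimes> g) \<otimes> x \<otimes> inv g"
    using assms by (simp only: m_assoc m_closed inv_closed nat_pow_closed)
  with Suc show ?case
    using assms by (simp add: m_assoc)
qed (use assms in simp)

lemma conj_eq_iff_commutes:
  assumes "g \<in> carrier G" "x \<in> carrier G"
  shows "g \<otimes> x \<otimes> inv g = x \<longleftrightarrow> g \<otimes> x = x \<otimes> g"
  using assms by (metis inv_closed inv_solve_right' m_closed)

text \<open>The orbit-stabilizer theorem for the action of the group on itself by conjugation.\<close>

lemma card_conj_class_mult_card_centralizer:
  assumes "x \<in> carrier G"
  shows "card (conj_class G x) * card (centralizer G (carrier G) {x}) = card (carrier G)"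
proof -
  interpret conj: group_action G "carrier G" "\<lambda>g. \<lambda>y \<in> carrier G. g \<otimes> y \<otimes> inv g"
    by (rule action_by_conjugation)
  have "stabilizer G (\<lambda>g. \<lambda>y \<in> carrier G. g \<otimes> y \<otimes> inv g) x = centralizer G (carrier G) {x}"
    using assms conj_eq_iff_commutes[OF _ assms]
    by (simp add: stabilizer_def centralizer_def cong: conj_cong)
  then show ?thesis
    using conj.orbit_stabilizer_theorem[OF assms] by (simp add: conj_class_def order_def)
qed

lemma conj_class_conjugate:
  assumes "g \<in> carrier G" "x \<in> carrier G"
  shows "conj_class G (g \<otimes> x \<otimes> inv g) = conj_class G x"
proof -
  let ?\<phi> = "\<lambda>g. \<lambda>y \<in> carrier G. g \<otimes> y \<otimes> inv g"
  interpret conj: group_action G "carrier G" ?\<phi>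
    by (rule action_by_conjugation)
  let ?y = "g \<otimes> x \<otimes> inv g"
  have y: "?y \<in> carrier G" "?y \<in> orbit G ?\<phi> x"
    using assms by (auto simp: orbit_def)
  then have "x \<in> orbit G ?\<phi> ?y"
    using assms conj.orbit_sym by blast
  moreover have "orbit G ?\<phi> z \<subseteq> carrier G" if "z \<in> carrier G" for z
    using that by (auto simp: orbit_def)
  ultimately show ?thesis
    unfolding conj_class_def using y assms conj.orbit_trans by (meson subset_antisym subset_eq)
qed

end

section \<open>Normal subgroups of coprime order and index\<close>

locale coprime_complement = normal N G for N H and G (structure) +
  assumes fin: "finite (carrier G)"
    and subgroup_H: "subgroup H G"
    and card_mult: "card N * card H = card (carrier G)"
    and coprime_cards: "coprime (card N) (card H)"
begin

lemma N_carrier [simp, intro]: "n \<in> N \<Longrightarrow> n \<in> carrier G"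
  by (rule mem_carrier)

lemma H_carrier [simp, intro]: "k \<in> H \<Longrightarrow> k \<in> carrier G"
  by (rule subgroup.mem_carrier[OF subgroup_H])

lemma subgroup_N: "subgroup N G"
  by (rule is_subgroup)

lemma finite_N: "finite N" and finite_H: "finite H"
  using fin finite_subset subgroup.subset subgroup_N subgroup_H by metis+

text \<open>By the Chinese remainder theorem there is \<open>e\<close> with \<open>e \<equiv> 0\<close> modulo \<open>|N|\<close> and
  \<open>e \<equiv> 1\<close> modulo \<open>|H|\<close>. Raising to the power \<open>e\<close> projects a product of commuting
  elements of \<open>N\<close> and \<open>H\<close> to its factor in \<open>H\<close>.\<close>

lemma coprime_exponent:
  obtains e :: nat where
    "\<And>c. c \<in> N \<Longrightarrow> c [^] e = \<one>" "\<And>h. h \<in> H \<Longrightarrow> h [^] e = h"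
proof -
  obtain e where e: "[e = 0] (mod card N)" "[e = 1] (mod card H)"
    using binary_chinese_remainder_nat[OF coprime_cards, of 0 1] by auto
  have pow_cong: "x [^] i = x [^] j"
    if "subgroup A G" "finite A" "x \<in> A" "[i = j] (mod card A)" for A x and i j :: nat
  proof -
    have x: "x \<in> carrier G" by (rule subgroup.mem_carrier[OF that(1,3)])
    have "x [^] m = x [^] (m mod card A)" for m :: nat
    proof -
      have "x [^] m = x [^] (card A * (m div card A) + m mod card A)"
        by simp
      also have "\<dots> = x [^] (m mod card A)"
        using x subgroup_pow_card_eq_one[OF that(1-3)]
        by (simp only: nat_pow_mult[symmetric] nat_pow_pow[symmetric] nat_pow_one nat_pow_closed l_one)
      finally show ?thesis .
    qed
    then show ?thesis using that(4) by (metis cong_def)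
  qed
  show thesis
  proof
    show "c [^] e = \<one>" if "c \<in> N" for c
      using pow_cong[OF subgroup_N finite_N that e(1)] by simp
    show "h [^] e = h" if "h \<in> H" for h
      using pow_cong[OF subgroup_H finite_H that e(2)] that by simp
  qed
qed

lemma Int_trivial:
  assumes "x \<in> N" "x \<in> H"
  shows "x = \<one>"
proof -
  obtain e :: nat where "x [^] e = \<one>" "x [^] e = x"
    using coprime_exponent assms by metis
  then show ?thesis by simp
qed

lemma factor_unique:
  assumes "n \<in> N" "n' \<in> N" "k \<in> H" "k' \<in> H" and eq: "n \<otimes> k = n' \<otimes> k'"
  shows "n = n'" "k = k'"
proof -
  have "inv n' \<otimes> n = inv n' \<otimes> (n \<otimes> k) \<otimes> inv k"
    using assms(1-4) by (simp add: m_assoc)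
  also have "\<dots> = inv n' \<otimes> (n' \<otimes> k') \<otimes> inv k"
    by (simp only: eq)
  also have "\<dots> = k' \<otimes> inv k"
    using assms(1-4) by (simp add: m_assoc[symmetric])
  finally have "inv n' \<otimes> n = k' \<otimes> inv k" .
  moreover have "inv n' \<otimes> n \<in> N"
    using assms(1,2) by simp
  moreover have "k' \<otimes> inv k \<in> H"
    using assms(3,4) subgroup_H by (simp add: subgroup.m_closed subgroup.m_inv_closed)
  ultimately have "inv n' \<otimes> n = \<one>"
    by (simp add: Int_trivial)
  then have "n' \<otimes> (inv n' \<otimes> n) = n'"
    using assms(2) by simp
  then show "n = n'"
    using assms(1,2) by (simp add: m_assoc[symmetric])
  with eq show "k = k'"
    using assms(1-4) by simp
qed

text \<open>Multiplication \<open>N \<times> H \<rightarrow> G\<close> is injective between sets of the same size.\<close>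

lemma factor_exists:
  assumes "g \<in> carrier G"
  obtains n k where "n \<in> N" "k \<in> H" "g = n \<otimes> k"
proof -
  let ?f = "\<lambda>(n, k). n \<otimes> k"
  have "inj_on ?f (N \<times> H)"
    using factor_unique by (auto simp: inj_on_def)
  then have "card (?f ` (N \<times> H)) = card (carrier G)"
    by (simp add: card_image card_cartesian_product card_mult)
  then have "?f ` (N \<times> H) = carrier G"
    using fin by (intro card_subset_eq) auto
  with assms that show thesis by force
qed

text \<open>The map \<open>(m, c) \<mapsto> m (c h) m\<^sup>-\<^sup>1\<close> from \<open>N \<times> C\<^sub>N(h)\<close> to the coset
  \<open>Nh\<close> has fibres of size at most \<open>|C\<^sub>N(h)|\<close>, so its image has at least \<open>|N| = |Nh|\<close>
  elements.\<close>

lemma conj_into_centralizer_coset: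
  assumes n: "n \<in> N" and h: "h \<in> H"
  obtains m c where "m \<in> N" "c \<in> centralizer G N {h}" "n \<otimes> h = m \<otimes> (c \<otimes> h) \<otimes> inv m"
proof -
  let ?C = "centralizer G N {h}"
  let ?f = "\<lambda>(m, c). m \<otimes> (c \<otimes> h) \<otimes> inv m"
  let ?I = "?f ` (N \<times> ?C)"
  have h': "h \<in> carrier G" using h by simp
  have finC: "finite ?C"
    using finite_N by (rule rev_finite_subset) (auto simp: centralizer_def)
  have subC: "subgroup ?C G"
    using h' by (intro subgroup_centralizer subgroup_N) simp
  have "\<one> \<in> ?C" using h' by simp
  then have posC: "card ?C > 0"
    using finC card_gt_0_iff by blast
  (* Normality: m c h m^-1 = (m c (h m^-1 h^-1)) h. *)
  have sub: "?I \<subseteq> N #> h"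
  proof clarify
    fix m c assume "m \<in> N" "c \<in> ?C"
    then have mc: "m \<in> N" "c \<in> N"
      by simp_all
    have "m \<otimes> (c \<otimes> h) \<otimes> inv m = m \<otimes> c \<otimes> (h \<otimes> inv m \<otimes> inv h) \<otimes> h"
      using mc h' by (simp add: m_assoc)
    moreover have "m \<otimes> c \<otimes> (h \<otimes> inv m \<otimes> inv h) \<in> N"
      using mc h' inv_op_closed2 by simp
    ultimately show "m \<otimes> (c \<otimes> h) \<otimes> inv m \<in> N #> h"
      by (auto simp: r_coset_def)
  qed
  obtain e :: nat where e: "\<And>c. c \<in> N \<Longrightarrow> c [^] e = \<one>" "\<And>h. h \<in> H \<Longrightarrow> h [^] e = h"
    using coprime_exponent by blast
  have f_pow: "?f (m, c) [^] e = m \<otimes> h \<otimes> inv m" if "m \<in> N" "c \<in> ?C" for m c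
    using that h e by (simp add: conj_pow pow_mult_distrib)
  (* Taking the e-th power of m c h m^-1 = m' c' h m'^-1 shows that m'^-1 m centralizes h.
     As m determines c within a fibre, z \<mapsto> m'^-1 (fst z) embeds the fibre into C_N(h). *)
  have fibre: "card {z \<in> N \<times> ?C. ?f z = y} \<le> card ?C" if y: "y \<in> ?I" for y
  proof -
    obtain m' c' where m'c': "m' \<in> N" "c' \<in> ?C" "y = ?f (m', c')"
      using y by (elim imageE SigmaE) blast
    have "inj_on (\<lambda>z. inv m' \<otimes> fst z) {z \<in> N \<times> ?C. ?f z = y}"
    proof (rule inj_onI)
      fix z z' assume "z \<in> {z \<in> N \<times> ?C. ?f z = y}" "z' \<in> {z \<in> N \<times> ?C. ?f z = y}"
        and "inv m' \<otimes> fst z = inv m' \<otimes> fst z'"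
      moreover obtain m c m1 c1 where "z = (m, c)" "z' = (m1, c1)"
        by fastforce
      ultimately have z: "z = (m, c)" "z' = (m, c1)" and "m \<in> N" "c \<in> N" "c1 \<in> N"
        and "m \<otimes> (c \<otimes> h) \<otimes> inv m = m \<otimes> (c1 \<otimes> h) \<otimes> inv m"
        using m'c'(1) by (simp_all del: in_centralizer_singleton) auto
      then have "c = c1"
        using h' by simp
      with z show "z = z'" by simp
    qed
    moreover have "(\<lambda>z. inv m' \<otimes> fst z) ` {z \<in> N \<times> ?C. ?f z = y} \<subseteq> ?C"
    proof (rule image_subsetI)
      fix z assume "z \<in> {z \<in> N \<times> ?C. ?f z = y}"
      then obtain m c where mc: "m \<in> N" "c \<in> ?C" "y = ?f (m, c)" and z: "z = (m, c)"
        by blast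
      then have "m \<otimes> h \<otimes> inv m = m' \<otimes> h \<otimes> inv m'"
        using f_pow[of m c] f_pow[of m' c'] m'c' by (simp del: in_centralizer_singleton)
      then have "inv m' \<otimes> (m \<otimes> h \<otimes> inv m) \<otimes> m = inv m' \<otimes> (m' \<otimes> h \<otimes> inv m') \<otimes> m"
        by simp
      then have "inv m' \<otimes> m \<otimes> h = h \<otimes> (inv m' \<otimes> m)"
        using mc(1) m'c'(1) h' by (simp add: m_assoc) (simp add: m_assoc[symmetric])
      then show "inv m' \<otimes> fst z \<in> ?C"
        using mc(1) m'c'(1) z by simp
    qed
    ultimately show ?thesis
      using finC by (metis (no_types, lifting) card_inj_on_le)
  qed
  have "card N * card ?C = card (\<Union>y\<in>?I. {z \<in> N \<times> ?C. ?f z = y})"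
    unfolding card_cartesian_product[symmetric] by (rule arg_cong[where f = card]) blast
  also have "\<dots> \<le> (\<Sum>y\<in>?I. card {z \<in> N \<times> ?C. ?f z = y})"
    using finC finite_N by (intro card_UN_le) auto
  also have "\<dots> \<le> card ?I * card ?C"
    using sum_mono[of ?I, OF fibre] by simp
  finally have "card N \<le> card ?I"
    using posC by simp
  moreover have "card (N #> h) = card N"
    using h' by (metis card_rcosets_equal rcosetsI subset)
  ultimately have "?I = N #> h"
    using sub finite_N by (intro card_seteq) (auto simp: r_coset_def)
  then have "n \<otimes> h \<in> ?I"
    using n by (auto simp: r_coset_def)
  with that show thesis by auto
qed

section \<open>Centralizers of elements of the complement\<close>

text \<open>If \<open>nk\<close> commutes with \<open>h\<close>, then \<open>n (kh) = (h n h\<^sup>-\<^sup>1) (hk)\<close> are two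
  factorizations of one element in \<open>NH\<close>, and uniqueness applies.\<close>

lemma product_commutes_with_H_iff:
  assumes n: "n \<in> N" and k: "k \<in> H" and h: "h \<in> H"
  shows "n \<otimes> k \<otimes> h = h \<otimes> (n \<otimes> k) \<longleftrightarrow> n \<otimes> h = h \<otimes> n \<and> k \<otimes> h = h \<otimes> k"
proof
  assume eq: "n \<otimes> k \<otimes> h = h \<otimes> (n \<otimes> k)"
  let ?n' = "h \<otimes> n \<otimes> inv h"
  have n': "?n' \<in> N"
    using n h by (simp add: inv_op_closed2)
  have n'h: "?n' \<otimes> h = h \<otimes> n"
    using n h by (simp add: m_assoc)
  have "n \<otimes> (k \<otimes> h) = h \<otimes> n \<otimes> k"
    using eq n k h by (simp add: m_assoc)
  also have "\<dots> = ?n' \<otimes> h \<otimes> k"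
    by (simp only: n'h)
  also have "\<dots> = ?n' \<otimes> (h \<otimes> k)"
    using N_carrier[OF n'] k h by (intro m_assoc) simp_all
  finally have eq': "n \<otimes> (k \<otimes> h) = ?n' \<otimes> (h \<otimes> k)" .
  have kh: "k \<otimes> h \<in> H" "h \<otimes> k \<in> H"
    using k h subgroup.m_closed[OF subgroup_H] by simp_all
  have "n = ?n'" "k \<otimes> h = h \<otimes> k"
    by (rule factor_unique[OF n n' kh eq'])+
  with n'h show "n \<otimes> h = h \<otimes> n \<and> k \<otimes> h = h \<otimes> k"
    by simp
next
  assume "n \<otimes> h = h \<otimes> n \<and> k \<otimes> h = h \<otimes> k"
  then show "n \<otimes> k \<otimes> h = h \<otimes> (n \<otimes> k)"
    using assms by (intro mult_commutes) simp_all
qed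

lemma centralizer_eq_set_mult:
  assumes "h \<in> H"
  shows "centralizer G (carrier G) {h} = centralizer G N {h} <#> centralizer G H {h}"
proof (intro equalityI subsetI)
  fix g assume g: "g \<in> centralizer G (carrier G) {h}"
  then obtain n k where nk: "n \<in> N" "k \<in> H" "g = n \<otimes> k"
    using factor_exists[of g] by auto
  with g assms have "n \<in> centralizer G N {h}" "k \<in> centralizer G H {h}"
    by (simp_all add: product_commutes_with_H_iff)
  with nk(3) show "g \<in> centralizer G N {h} <#> centralizer G H {h}"
    unfolding set_mult_def by blast
next
  fix g assume "g \<in> centralizer G N {h} <#> centralizer G H {h}"
  with assms show "g \<in> centralizer G (carrier G) {h}"
    by (auto simp: set_mult_def product_commutes_with_H_iff)
qed

lemma subgroup_index_centralizer_mult_card: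
  assumes "subgroup A G" "h \<in> H"
  shows "subgroup_index G A (centralizer G A {h}) * card (centralizer G A {h}) = card A"
proof (rule subgroup_index_mult_card)
  show "finite A"
    using fin assms(1) finite_subset subgroup.subset by blast
qed (use assms in \<open>auto intro!: subgroup_centralizer\<close>)

text \<open>The orbit-stabilizer theorem and the factorization of \<open>C\<^sub>G(h)\<close>, where both
  \<open>|G|\<close> and \<open>|C\<^sub>G(h)|\<close> split as products over \<open>N\<close> and \<open>H\<close>.\<close>

lemma card_conj_class_H:
  assumes h: "h \<in> H"
  shows "card (conj_class G h) =
    subgroup_index G N (centralizer G N {h}) * subgroup_index G H (centralizer G H {h})"
proof -
  let ?CN = "centralizer G N {h}" and ?CH = "centralizer G H {h}"
  let ?f = "\<lambda>(n, k). n \<otimes> k"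
  have "inj_on ?f (?CN \<times> ?CH)"
    using factor_unique by (auto simp: inj_on_def)
  moreover have "?f ` (?CN \<times> ?CH) = ?CN <#> ?CH"
    by (auto simp: set_mult_def)
  ultimately have C: "card (centralizer G (carrier G) {h}) = card ?CN * card ?CH"
    using h by (metis card_cartesian_product card_image centralizer_eq_set_mult)
  have "card (conj_class G h) * (card ?CN * card ?CH) = card N * card H"
    using card_conj_class_mult_card_centralizer[of h] h C card_mult by simp
  also have "\<dots> = (subgroup_index G N ?CN * card ?CN) * (subgroup_index G H ?CH * card ?CH)"
    using subgroup_index_centralizer_mult_card subgroup_N subgroup_H h by simp
  finally have "card (conj_class G h) * (card ?CN * card ?CH) =
      subgroup_index G N ?CN * subgroup_index G H ?CH * (card ?CN * card ?CH)"
    by (simp only: mult_ac)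
  moreover have "\<one> \<in> ?CN" "\<one> \<in> ?CH" "finite ?CN" "finite ?CH"
    using h finite_N finite_H subgroup.one_closed[OF subgroup_H]
    by (auto simp: centralizer_def)
  then have "card ?CN > 0" "card ?CH > 0"
    by (metis card_gt_0_iff empty_iff)+
  then have "card ?CN * card ?CH \<noteq> 0"
    by simp
  ultimately show ?thesis
    by (simp only: mult_cancel_right) simp
qed

text \<open>What commutes with \<open>ch\<close> commutes with its power \<open>h = (ch)\<^sup>e\<close>, and then with
  \<open>c\<close>; hence \<open>C\<^sub>G(ch) = C\<^sub>G(c) \<inter> C\<^sub>G(h)\<close>.\<close>

lemma commutes_with_product_iff:
  assumes c: "c \<in> centralizer G N {h}" and h: "h \<in> H" and g: "g \<in> carrier G"
  shows "g \<otimes> (c \<otimes> h) = c \<otimes> h \<otimes> g \<longleftrightarrow> g \<otimes> c = c \<otimes> g \<and> g \<otimes> h = h \<otimes> g"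
proof
  assume eq: "g \<otimes> (c \<otimes> h) = c \<otimes> h \<otimes> g"
  have c': "c \<in> N" "c \<otimes> h = h \<otimes> c"
    using c by simp_all
  obtain e :: nat where e: "\<And>c. c \<in> N \<Longrightarrow> c [^] e = \<one>" "\<And>h. h \<in> H \<Longrightarrow> h [^] e = h"
    using coprime_exponent by blast
  have "(c \<otimes> h) [^] e = h"
    using c' h e by (simp add: pow_mult_distrib)
  then have gh: "g \<otimes> h = h \<otimes> g"
    using pow_commutes[of "c \<otimes> h" g e] eq c'(1) h g by simp
  have "g \<otimes> c \<otimes> h = c \<otimes> h \<otimes> g"
    using eq c'(1) h g by (simp add: m_assoc)
  also have "\<dots> = c \<otimes> g \<otimes> h"
    using gh c'(1) h g by (simp add: m_assoc)
  finally show "g \<otimes> c = c \<otimes> g \<and> g \<otimes> h = h \<otimes> g"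
    using gh c'(1) h g by simp
next
  assume "g \<otimes> c = c \<otimes> g \<and> g \<otimes> h = h \<otimes> g"
  then show "g \<otimes> (c \<otimes> h) = c \<otimes> h \<otimes> g"
    using mult_commutes[of c h g] assms by simp
qed

text \<open>Equal class sizes mean equal centralizer orders, and \<open>C\<^sub>G(ch)\<close> is contained
  in \<open>C\<^sub>G(h)\<close>.\<close>

lemma card_conj_class_eq_iff:
  assumes c: "c \<in> centralizer G N {h}" and h: "h \<in> H"
  shows "card (conj_class G (c \<otimes> h)) = card (conj_class G h) \<longleftrightarrow>
    centralizer G (carrier G) {h} \<subseteq> centralizer G (carrier G) {c}"
proof -
  let ?C = "\<lambda>x. centralizer G (carrier G) {x}"
  have carr: "c \<otimes> h \<in> carrier G" "h \<in> carrier G"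
    using c h by simp_all
  have C: "?C (c \<otimes> h) = ?C h \<inter> ?C c"
    using commutes_with_product_iff[OF c h] by auto
  have fin_C: "finite (?C x)" for x
    using fin by (simp add: centralizer_def)
  have pos: "card (carrier G) > 0"
    using fin card_gt_0_iff by blast
  have "card (conj_class G (c \<otimes> h)) = card (conj_class G h) \<longleftrightarrow> card (?C (c \<otimes> h)) = card (?C h)"
    using carr[THEN card_conj_class_mult_card_centralizer] pos
    by (metis mult.commute mult_left_cancel mult_zero_left less_numeral_extra(3))
  also have "\<dots> \<longleftrightarrow> ?C (c \<otimes> h) = ?C h"
    using C fin_C by (metis card_subset_eq inf_le1)
  finally show ?thesis
    using C by auto
qed

text \<open>Both sides say that \<open>C\<^sub>N(h)\<close> commutes elementwise with
  \<open>C\<^sub>G(h) = C\<^sub>N(h) C\<^sub>H(h)\<close>: commutativity of \<open>C\<^sub>N(h)\<close> takes care of the first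
  factor, and \<open>C\<^sub>N(h) \<le> C\<^sub>N(C\<^sub>H(h))\<close> of the second. The reverse inclusion is automatic,
  as \<open>h \<in> C\<^sub>H(h)\<close>.\<close>

lemma centralizes_iff:
  assumes h: "h \<in> H"
  shows "(\<forall>c \<in> centralizer G N {h}. centralizer G (carrier G) {h} \<subseteq> centralizer G (carrier G) {c}) \<longleftrightarrow>
    centralizer G N (centralizer G H {h}) = centralizer G N {h} \<and>
    comm_group (G\<lparr>carrier := centralizer G N {h}\<rparr>)" (is "?L \<longleftrightarrow> ?R")
proof
  let ?CN = "centralizer G N {h}" and ?CH = "centralizer G H {h}"
  have CN: "subgroup ?CN G"
    using h by (intro subgroup_centralizer subgroup_N) simp
  assume L: ?L
  have comm: "c \<otimes> g = g \<otimes> c" if "c \<in> ?CN" "g \<in> carrier G" "g \<otimes> h = h \<otimes> g" for c g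
  proof -
    have "g \<in> centralizer G (carrier G) {h}"
      using that(2,3) by simp
    then have "g \<in> centralizer G (carrier G) {c}"
      using L that(1) by blast
    then show ?thesis by simp
  qed
  have "centralizer G N ?CH = ?CN"
  proof (intro equalityI subsetI)
    fix c assume "c \<in> centralizer G N ?CH"
    with h show "c \<in> ?CN"
      by (auto simp: centralizer_def)
  next
    fix c assume "c \<in> ?CN"
    with comm[OF this] show "c \<in> centralizer G N ?CH"
      by (auto simp: centralizer_def)
  qed
  moreover have "comm_group (G\<lparr>carrier := ?CN\<rparr>)"
  proof (rule group.group_comm_groupI)
    show "group (G\<lparr>carrier := ?CN\<rparr>)"
      using CN by (rule subgroup.subgroup_is_group) (rule is_group)
  qed (use comm in auto)
  ultimately show ?R ..
next
  let ?CN = "centralizer G N {h}" and ?CH = "centralizer G H {h}"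
  assume R: ?R
  then interpret CN: comm_group "G\<lparr>carrier := ?CN\<rparr>" by simp
  show ?L
  proof (intro ballI subsetI)
    fix c g assume c: "c \<in> ?CN" and "g \<in> centralizer G (carrier G) {h}"
    then obtain n k where nk: "n \<in> ?CN" "k \<in> ?CH" "g = n \<otimes> k"
      using h by (auto simp: centralizer_eq_set_mult set_mult_def)
    have "n \<otimes> c = c \<otimes> n"
      using CN.m_comm[of n c] nk(1) c by simp
    moreover have "c \<in> centralizer G N ?CH"
      using R c by simp
    then have "k \<otimes> c = c \<otimes> k"
      using nk(2) by (simp add: centralizer_def)
    ultimately show "g \<in> centralizer G (carrier G) {c}"
      using nk c by (auto intro: mult_commutes)
  qed
qed

section \<open>Class sizes outside \<open>N C\<^sub>H(N)\<close>\<close>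

lemma mem_N_mult_centralizer_iff:
  assumes "n \<in> N" "h \<in> H"
  shows "n \<otimes> h \<in> N <#> centralizer G H N \<longleftrightarrow> h \<in> centralizer G H N"
proof
  assume "n \<otimes> h \<in> N <#> centralizer G H N"
  then obtain n' z where "n' \<in> N" "z \<in> centralizer G H N" "n \<otimes> h = n' \<otimes> z"
    by (auto simp: set_mult_def)
  with factor_unique(2)[of n n' h z] assms show "h \<in> centralizer G H N"
    by (auto simp: centralizer_def)
qed (use assms in \<open>auto simp: set_mult_def\<close>)

text \<open>Each element of \<open>G\<close> lies in a coset \<open>Nh\<close> and so is conjugate to some
  \<open>ch\<close> with \<open>c \<in> C\<^sub>N(h)\<close>; the class sizes of these elements are all that matters.\<close>

lemma all_class_sizes_iff:
  "(\<forall>x \<in> carrier G - (N <#> centralizer G H N). card (conj_class G x) = s) \<longleftrightarrow>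
   (\<forall>h \<in> H - centralizer G H N. \<forall>c \<in> centralizer G N {h}. card (conj_class G (c \<otimes> h)) = s)"
  (is "?L \<longleftrightarrow> ?R")
proof
  assume L: ?L
  show ?R
  proof (intro ballI)
    fix h c assume h: "h \<in> H - centralizer G H N" and "c \<in> centralizer G N {h}"
    then have "c \<in> N" by simp
    then have "c \<otimes> h \<in> carrier G - (N <#> centralizer G H N)"
      using h mem_N_mult_centralizer_iff by simp
    with L show "card (conj_class G (c \<otimes> h)) = s" by blast
  qed
next
  assume R: ?R
  show ?L
  proof
    fix x assume x: "x \<in> carrier G - (N <#> centralizer G H N)"
    then obtain n h where nh: "n \<in> N" "h \<in> H" "x = n \<otimes> h"
      using factor_exists by blast
    then obtain m c where mc: "m \<in> N" "c \<in> centralizer G N {h}" "x = m \<otimes> (c \<otimes> h) \<otimes> inv m"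
      using conj_into_centralizer_coset by metis
    then have "conj_class G x = conj_class G (c \<otimes> h)"
      using nh(2) conj_class_conjugate[of m "c \<otimes> h"] by simp
    moreover have "h \<in> H - centralizer G H N"
      using x nh mem_N_mult_centralizer_iff by blast
    ultimately show "card (conj_class G x) = s"
      using R mc(2) by simp
  qed
qed

text \<open>For fixed \<open>h\<close>, the choice \<open>c = 1\<close> gives the class size of \<open>h\<close> itself as the
  product of the two indices; that every other \<open>ch\<close> has a class of this same size is a
  condition on centralizers.\<close>

lemma all_class_sizes_iff_centralizers:
  "(\<forall>x \<in> carrier G - (N <#> centralizer G H N). card (conj_class G x) = s) \<longleftrightarrow>
   (\<forall>h \<in> H - centralizer G H N.
      subgroup_index G N (centralizer G N {h}) * subgroup_index G H (centralizer G H {h}) = s \<and>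
      centralizer G N (centralizer G H {h}) = centralizer G N {h} \<and>
      comm_group (G\<lparr>carrier := centralizer G N {h}\<rparr>))"
proof -
  have "(\<forall>c \<in> centralizer G N {h}. card (conj_class G (c \<otimes> h)) = s) \<longleftrightarrow>
      subgroup_index G N (centralizer G N {h}) * subgroup_index G H (centralizer G H {h}) = s \<and>
      centralizer G N (centralizer G H {h}) = centralizer G N {h} \<and>
      comm_group (G\<lparr>carrier := centralizer G N {h}\<rparr>)" (is "?L \<longleftrightarrow> ?R") if h: "h \<in> H" for h
  proof -
    have "\<one> \<in> centralizer G N {h}" "\<one> \<otimes> h = h"
      using h by simp_all
    then have "?L \<longleftrightarrow> card (conj_class G h) = s \<and>
        (\<forall>c \<in> centralizer G N {h}. card (conj_class G (c \<otimes> h)) = card (conj_class G h))"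
      by metis
    also have "\<dots> \<longleftrightarrow> ?R"
      using h card_conj_class_eq_iff card_conj_class_H centralizes_iff by simp
    finally show ?thesis .
  qed
  then show ?thesis
    unfolding all_class_sizes_iff by blast
qed

end

section \<open>Hall subgroups\<close>

text \<open>From \<open>|G : N| |N| = |G : H| |H|\<close>, where \<open>|N|\<close> and \<open>|G : H|\<close> are \<open>\<pi>\<close>-numbers
  and \<open>|H|\<close> and \<open>|G : N|\<close> are \<open>\<pi>'\<close>-numbers, it follows that \<open>|H| = |G : N|\<close>.\<close>

lemma (in group) coprime_complement_of_hall:
  assumes fin: "finite (carrier G)" and \<pi>: "\<forall>p \<in> \<pi>. prime p"
    and N: "N \<lhd> G" "hall_subgroup G \<pi> N" and H: "pi_complement G \<pi> H"
  shows "coprime_complement N H G"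
proof -
  note hall = N(2) H[unfolded pi_complement_def]
  have sub: "subgroup N G" "subgroup H G"
    and piN: "pi_number \<pi> (card N)"
    and piG_N: "pi_number (prime_compl \<pi>) (subgroup_index G (carrier G) N)"
    and piH: "pi_number (prime_compl \<pi>) (card H)"
    and piG_H: "pi_number \<pi> (subgroup_index G (carrier G) H)"
    using hall by (simp_all add: hall_subgroup_def prime_compl_involutive[OF \<pi>])
  have index: "subgroup_index G (carrier G) K * card K = card (carrier G)" if "subgroup K G" for K
    using that fin by (intro subgroup_index_mult_card subgroup_self) (auto dest: subgroup.subset)
  have copr: "coprime (card N) (card H)"
    using coprime_pi_numbers[OF piN piH] .
  have "subgroup_index G (carrier G) N * card N = subgroup_index G (carrier G) H * card H"
    using index sub by simp
  then have "card H dvd subgroup_index G (carrier G) N" "subgroup_index G (carrier G) N dvd card H"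
    using copr coprime_pi_numbers[OF piG_H piG_N]
    by (metis coprime_commute coprime_dvd_mult_left_iff dvd_triv_right,
        metis coprime_commute coprime_dvd_mult_right_iff dvd_triv_left)
  then have "card H = subgroup_index G (carrier G) N"
    by (rule dvd_antisym)
  then have "card N * card H = card (carrier G)"
    using index[OF sub(1)] by (simp add: mult.commute)
  with N(1) fin sub(2) copr show ?thesis
    by (simp add: coprime_complement_def coprime_complement_axioms_def)
qed

theorem theorem2p4:
  fixes G :: "('a, 'b) monoid_scheme" (structure)
    and \<pi> :: "nat set"
    and N H :: "'a set"
  assumes "group G" and "finite (carrier G)"
    and "\<forall>p \<in> \<pi>. prime p"
    and "N \<lhd> G" and "hall_subgroup G \<pi> N"
    and "pi_complement G \<pi> H"
  shows "((\<exists>s::nat. s > 0 \<and>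
            (\<forall>x \<in> carrier G - (N <#> centralizer G H N). card (conj_class G x) = s))
          \<longleftrightarrow>
          (\<exists>a. \<forall>h \<in> H - centralizer G H N. subgroup_index G H (centralizer G H {h}) = a) \<and>
          (\<exists>b. \<forall>h \<in> H - centralizer G H N. subgroup_index G N (centralizer G N {h}) = b) \<and>
          (\<forall>h \<in> H - centralizer G H N.
             centralizer G N (centralizer G H {h}) = centralizer G N {h}) \<and>
          (\<forall>h \<in> H - centralizer G H N. comm_group (G\<lparr>carrier := centralizer G N {h}\<rparr>)))
       \<and> (\<forall>s::nat. s > 0 \<and>
            (\<forall>x \<in> carrier G - (N <#> centralizer G H N). card (conj_class G x) = s)
          \<longrightarrow> (\<forall>h \<in> H - centralizer G H N.
                subgroup_index G H (centralizer G H {h}) = pi_part (prime_compl \<pi>) s \<and>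
                subgroup_index G N (centralizer G N {h}) = pi_part \<pi> s))"
proof -
  interpret coprime_complement N H G
    using group.coprime_complement_of_hall[OF assms] .
  let ?out = "H - centralizer G H N"
  let ?iN = "\<lambda>h. subgroup_index G N (centralizer G N {h})"
  let ?iH = "\<lambda>h. subgroup_index G H (centralizer G H {h})"
  let ?const = "\<lambda>s. \<forall>x \<in> carrier G - (N <#> centralizer G H N). card (conj_class G x) = s"
  let ?c = "\<forall>h \<in> ?out. centralizer G N (centralizer G H {h}) = centralizer G N {h}"
  let ?d = "\<forall>h \<in> ?out. comm_group (G\<lparr>carrier := centralizer G N {h}\<rparr>)"
  note const_iff = all_class_sizes_iff_centralizers
  have pi_iN: "pi_number \<pi> (?iN h)" and pi_iH: "pi_number (prime_compl \<pi>) (?iH h)" if "h \<in> H" for h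
    using assms(5,6) subgroup_index_centralizer_mult_card[OF subgroup_N that]
      subgroup_index_centralizer_mult_card[OF subgroup_H that]
    unfolding hall_subgroup_def pi_complement_def by (metis dvd_triv_left pi_number_dvd)+
  have parts: "?iH h = pi_part (prime_compl \<pi>) s \<and> ?iN h = pi_part \<pi> s"
    if "?const s" "h \<in> ?out" for s h
  proof -
    have h: "h \<in> H" and s: "?iN h * ?iH h = s"
      using that const_iff[of s] by blast+
    have "pi_part \<pi> (?iN h * ?iH h) = ?iN h"
      using pi_part_mult pi_iN pi_iH h by blast
    moreover have "pi_part (prime_compl \<pi>) (?iH h * ?iN h) = ?iH h"
      using pi_part_mult[of "prime_compl \<pi>"] pi_iN pi_iH h
      by (simp add: prime_compl_involutive[OF assms(3)])
    ultimately show ?thesis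
      using s by (simp add: mult.commute)
  qed
  have "(\<exists>s>0. ?const s) \<longleftrightarrow> (\<exists>a. \<forall>h\<in>?out. ?iH h = a) \<and> (\<exists>b. \<forall>h\<in>?out. ?iN h = b) \<and> ?c \<and> ?d"
  proof
    assume "\<exists>s>0. ?const s"
    then obtain s where s: "?const s" by blast
    have "?c \<and> ?d"
      using s unfolding const_iff by blast
    with parts[OF s] show "(\<exists>a. \<forall>h\<in>?out. ?iH h = a) \<and> (\<exists>b. \<forall>h\<in>?out. ?iN h = b) \<and> ?c \<and> ?d"
      by blast
  next
    assume "(\<exists>a. \<forall>h\<in>?out. ?iH h = a) \<and> (\<exists>b. \<forall>h\<in>?out. ?iN h = b) \<and> ?c \<and> ?d"
    then obtain a b where *: "\<forall>h\<in>?out. ?iH h = a" "\<forall>h\<in>?out. ?iN h = b" "?c" "?d"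
      by blast
    show "\<exists>s>0. ?const s"
    proof (cases "?out = {}")
      case True
      (* G = N C_H(N): any positive s will do. *)
      then have "?const 1"
        unfolding const_iff by blast
      then show ?thesis
        using zero_less_one by blast
    next
      case False
      then obtain h where h: "h \<in> ?out" by blast
      have "b * a > 0"
        using * h pi_iN[of h] pi_iH[of h] by (auto simp: pi_number_def)
      moreover have "?const (b * a)"
        unfolding const_iff using * by simp
      ultimately show ?thesis by blast
    qed
  qed
  with parts show ?thesis
    by blast
qed

end
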